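(* Let $\mathbf{C}$ be an antilinear operator on $L^2\oplus L^2$. Then $\mathbf{C}=\begin{bmatrix} D_1 & D_2\\ D_2^\sharp & D_4\end{bmatrix}$ (with $D_1,D_2,D_4$ bounded antilinear operators on $L^2$) is a conjugation such that $\mathbf{M}_z\mathbf{C}=\mathbf{C}\mathbf{M}_z$ if and only if there are functions $\psi_i\in L^\infty$, $i=1,2,4$, such that $D_i=M_{\psi_i}J^\star$ and $$\psi_1^{\#}=\overline{\psi_1},\qquad \psi_4^{\#}=\overline{\psi_4},$$ $$|\psi_1|^2=|\psi_4|^2=1-|\psi_2|^2,$$ $$\psi_1^{\#}\psi_2+\psi_2^{\#}\psi_4=0$$ (a.e. on $\mathbb{T}$).
   Context: $L^2=L^2(\mathbb{T},m)$ and $L^\infty=L^\infty(\mathbb{T},m)$, with $\mathbb{T}$ the unit circle and $m$ normalized Lebesgue measure (complex-valued functions). A conjugation on a Hilbert space $\mathcal{K}$ is an antilinear map $C:\mathcal{K}\to\mathcal{K}$ with $C^2=I$ and $\langle Cf,Cg\rangle=\langle g,f\rangle$ for all $f,g$. For a bounded antilinear operator $A$, its antilinear adjoint $A^\sharp$ is the unique antilinear operator with $\langle Af,g\rangle=\overline{\langle f,A^\sharp g\rangle}$ for all $f,g$. For $f\in L^2$ (or $L^\infty$), $f^{\#}(z)=\overline{f(\bar z)}$, and $J^\star f=f^{\#}$ on $L^2$. $M_\psi$ is multiplication by $\psi$ on $L^2$, $M_z$ is multiplication by $z$, and $\mathbf{M}_z=\begin{bmatrix}M_z&0\\0&M_z\end{bmatrix}$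 on $L^2\oplus L^2$. *)

theory Defs
  imports "HOL-Analysis.Analysis"
begin

section \<open>Complex inner product spaces\<close>

text \<open>
  The real inner product (hence norm and topology) is the real part of the complex one, which is
  linear in its first argument.
\<close>

class complex_inner = real_inner +
  fixes scaleC :: "complex \<Rightarrow> 'a \<Rightarrow> 'a"  (infixr "*\<^sub>C" 75)
    and cinner :: "'a \<Rightarrow> 'a \<Rightarrow> complex"
  assumes scaleC_add_right: "c *\<^sub>C (x + y) = c *\<^sub>C x + c *\<^sub>C y"
    and scaleC_add_left: "(c + d) *\<^sub>C x = c *\<^sub>C x + d *\<^sub>C x"
    and scaleC_scaleC: "c *\<^sub>C d *\<^sub>C x = (c * d) *\<^sub>C x"
    and scaleC_of_real: "complex_of_real r *\<^sub>C x = r *\<^sub>R x"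
    and cinner_commute: "cinner x y = cnj (cinner y x)"
    and cinner_add_left: "cinner (x + y) z = cinner x z + cinner y z"
    and cinner_scaleC_left: "cinner (c *\<^sub>C x) y = c * cinner x y"
    and Re_cinner: "Re (cinner x y) = inner x y"

instantiation prod :: (complex_inner, complex_inner) complex_inner
begin

definition scaleC_prod :: "complex \<Rightarrow> 'a \<times> 'b \<Rightarrow> 'a \<times> 'b" where
  "scaleC_prod c x = (c *\<^sub>C fst x, c *\<^sub>C snd x)"

definition cinner_prod :: "'a \<times> 'b \<Rightarrow> 'a \<times> 'b \<Rightarrow> complex" where
  "cinner_prod x y = cinner (fst x) (fst y) + cinner (snd x) (snd y)"

instance
proof
  fix x y z :: "'a \<times> 'b" and c d :: complex and r :: real
  show "c *\<^sub>C (x + y) = c *\<^sub>C x + c *\<^sub>C y"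
    by (simp add: scaleC_prod_def scaleC_add_right)
  show "(c + d) *\<^sub>C x = c *\<^sub>C x + d *\<^sub>C x"
    by (simp add: scaleC_prod_def scaleC_add_left)
  show "c *\<^sub>C d *\<^sub>C x = (c * d) *\<^sub>C x"
    by (simp add: scaleC_prod_def scaleC_scaleC)
  show "complex_of_real r *\<^sub>C x = r *\<^sub>R x"
    by (simp add: scaleC_prod_def scaleC_of_real scaleR_prod_def)
  show "cinner x y = cnj (cinner y x)"
    by (simp add: cinner_prod_def flip: cinner_commute)
  show "cinner (x + y) z = cinner x z + cinner y z"
    by (simp add: cinner_prod_def cinner_add_left)
  show "cinner (c *\<^sub>C x) y = c * cinner x y"
    by (simp add: cinner_prod_def scaleC_prod_def cinner_scaleC_left distrib_left)
  show "Re (cinner x y) = inner x y"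
    by (simp add: cinner_prod_def inner_prod_def Re_cinner)
qed

end

definition antilinear :: "('a::complex_inner \<Rightarrow> 'b::complex_inner) \<Rightarrow> bool" where
  "antilinear A \<longleftrightarrow>
     (\<forall>x y. A (x + y) = A x + A y) \<and> (\<forall>c x. A (c *\<^sub>C x) = cnj c *\<^sub>C A x)"

definition bounded_antilinear :: "('a::complex_inner \<Rightarrow> 'b::complex_inner) \<Rightarrow> bool" where
  "bounded_antilinear A \<longleftrightarrow> antilinear A \<and> (\<exists>K. \<forall>x. norm (A x) \<le> norm x * K)"

definition conjugation :: "('a::complex_inner \<Rightarrow> 'a) \<Rightarrow> bool" where
  "conjugation C \<longleftrightarrow>
     antilinear C \<and> C \<circ> C = id \<and> (\<forall>f g. cinner (C f) (C g) = cinner g f)"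

text \<open>Uniquely determined when it exists; on a Hilbert space it exists for every bounded \<open>A\<close>.\<close>

definition antilinear_adjoint ::
    "('a::complex_inner \<Rightarrow> 'b::complex_inner) \<Rightarrow> 'b \<Rightarrow> 'a" where
  "antilinear_adjoint A =
     (THE B. antilinear B \<and> (\<forall>f g. cinner (A f) g = cnj (cinner f (B g))))"

definition block_operator ::
    "('a::plus \<Rightarrow> 'a) \<Rightarrow> ('a \<Rightarrow> 'a) \<Rightarrow> ('a \<Rightarrow> 'a) \<Rightarrow> ('a \<Rightarrow> 'a) \<Rightarrow> 'a \<times> 'a \<Rightarrow> 'a \<times> 'a" where
  "block_operator A B C D = (\<lambda>(f, g). (A f + B g, C f + D g))"


section \<open>The unit circle, \<open>L\<^sup>\<infinity>\<close> and \<open>L\<^sup>2\<close>\<close>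

text \<open>
  Normalized arc length: the image of the uniform distribution on \<open>[-\<pi>, \<pi>]\<close> under
  \<open>t \<mapsto> e\<^sup>i\<^sup>t\<close>.
\<close>

definition circle_measure :: "complex measure" where
  "circle_measure =
     distr (uniform_measure lborel {-pi..pi}) (restrict_space borel (sphere 0 1)) cis"

text \<open>
  Elements of \<open>L\<^sup>\<infinity>\<close> are represented by functions, to be compared almost everywhere; \<open>L\<^sup>2\<close> is the
  type \<open>L2_circle\<close> of almost-everywhere classes. Values off the circle are irrelevant.
\<close>

definition Linfty :: "(complex \<Rightarrow> complex) set" where
  "Linfty = {\<psi> \<in> borel_measurable circle_measure. \<exists>B. AE z in circle_measure. cmod (\<psi> z) \<le> B}"

definition sharp :: "(complex \<Rightarrow> complex) \<Rightarrow> complex \<Rightarrow> complex" where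
  "sharp f = (\<lambda>z. cnj (f (cnj z)))"

definition square_integrable :: "(complex \<Rightarrow> complex) \<Rightarrow> bool" where
  "square_integrable f \<longleftrightarrow>
     f \<in> borel_measurable circle_measure \<and> integrable circle_measure (\<lambda>z. (cmod (f z))\<^sup>2)"

lemma cis_measurable_circle:
  "cis \<in> uniform_measure lborel {-pi..pi} \<rightarrow>\<^sub>M restrict_space borel (sphere 0 1)"
proof -
  have "cis \<in> borel_measurable (borel :: real measure)"
    by (intro borel_measurable_continuous_onI continuous_intros)
  then show ?thesis
    by (intro measurable_restrict_space2)
       (auto cong: measurable_cong_sets)
qed

lemma space_circle_measure [simp]: "space circle_measure = sphere 0 1"
  by (simp add: circle_measure_def space_restrict_space)

lemma sets_circle_measure [measurable_cong]:
  "sets circle_measure = sets (restrict_space borel (sphere 0 1))"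
  by (simp add: circle_measure_def)

lemma prob_circle_measure: "emeasure circle_measure (space circle_measure) = 1"
proof -
  have "emeasure circle_measure (sphere 0 1) = emeasure (uniform_measure lborel {-pi..pi}) UNIV"
    unfolding circle_measure_def
    by (subst emeasure_distr[OF cis_measurable_circle])
       (auto simp: sets_restrict_space vimage_def)
  also have "\<dots> = 1"
    by (subst emeasure_uniform_measure)
       (auto simp: ennreal_divide_self simp flip: ennreal_0)
  finally show ?thesis by simp
qed

lemma cnj_measurable_circle [measurable]: "cnj \<in> circle_measure \<rightarrow>\<^sub>M circle_measure"
proof -
  have "cnj \<in> borel_measurable (borel :: complex measure)"
    by (intro borel_measurable_continuous_onI continuous_intros)
  then have "cnj \<in> restrict_space borel (sphere 0 1) \<rightarrow>\<^sub>M restrict_space borel (sphere 0 1)"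
    by (intro measurable_restrict_space2 measurable_restrict_space1)
       (auto simp: space_restrict_space)
  then show ?thesis
    by (simp cong: measurable_cong_sets add: sets_circle_measure)
qed

lemma distr_cnj_circle_measure: "distr circle_measure circle_measure cnj = circle_measure"
proof -
  let ?U = "uniform_measure lborel {-pi..pi}"
  let ?S = "restrict_space borel (sphere (0::complex) 1)"
  have U: "distr ?U ?U uminus = ?U"
  proof (rule measure_eqI)
    show "sets (distr ?U ?U uminus) = sets ?U"
      by simp
    fix A assume "A \<in> sets (distr ?U ?U uminus)"
    then have A: "A \<in> sets borel" by simp
    have m: "uminus \<in> ?U \<rightarrow>\<^sub>M ?U"
      by (simp cong: measurable_cong_sets)
    have [measurable]: "uminus \<in> borel_measurable (borel :: real measure)" by simp
    have B: "uminus -` A \<in> sets borel" 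
      using measurable_sets[of uminus "borel :: real measure" borel A] A by simp
    have "emeasure lborel ({-pi..pi} \<inter> A) =
          emeasure (distr lborel borel uminus) ({-pi..pi} \<inter> A)"
      by (simp add: lborel_distr_uminus)
    also have "\<dots> = emeasure lborel (uminus -` ({-pi..pi} \<inter> A))"
      using A by (subst emeasure_distr) auto
    also have "uminus -` ({-pi..pi} \<inter> A) = {-pi..pi} \<inter> uminus -` A"
      by auto
    finally have eq: "emeasure lborel ({-pi..pi} \<inter> uminus -` A) = emeasure lborel ({-pi..pi} \<inter> A)"
      by simp
    have "emeasure (distr ?U ?U uminus) A = emeasure ?U (uminus -` A)"
      using A by (subst emeasure_distr[OF m]) auto
    also have "\<dots> = emeasure ?U A"
      using A B by (simp add: eq)
    finally show "emeasure (distr ?U ?U uminus) A = emeasure ?U A" .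
  qed
  have m: "uminus \<in> ?U \<rightarrow>\<^sub>M ?U"
    by (simp cong: measurable_cong_sets)
  have c: "cnj \<in> ?S \<rightarrow>\<^sub>M circle_measure"
    using cnj_measurable_circle by (simp cong: measurable_cong_sets add: sets_circle_measure)
  have "distr circle_measure circle_measure cnj = distr ?U circle_measure (cnj \<circ> cis)"
    by (subst (1) circle_measure_def, subst distr_distr[OF c cis_measurable_circle]) simp
  also have "cnj \<circ> cis = cis \<circ> uminus"
    by (auto simp: cis_cnj)
  also have "distr ?U circle_measure (cis \<circ> uminus) = distr ?U ?S (cis \<circ> uminus)"
    by (rule distr_cong) (auto simp: sets_circle_measure)
  also have "\<dots> = distr (distr ?U ?U uminus) ?S cis"
    by (rule distr_distr[OF cis_measurable_circle m, symmetric])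
  also have "\<dots> = circle_measure"
    by (simp only: U circle_measure_def)
  finally show ?thesis .
qed

lemma AE_circle_cnj:
  assumes "AE z in circle_measure. P z"
  shows "AE z in circle_measure. P (cnj z)"
proof -
  have "AE z in distr circle_measure circle_measure cnj. P z"
    by (subst distr_cnj_circle_measure) (rule assms)
  then show ?thesis
    by (rule AE_distrD[OF cnj_measurable_circle])
qed

lemma square_integrable_add:
  assumes "square_integrable f" "square_integrable g"
  shows "square_integrable (\<lambda>z. f z + g z)"
proof -
  have [measurable]: "f \<in> borel_measurable circle_measure" "g \<in> borel_measurable circle_measure"
    and i: "integrable circle_measure (\<lambda>z. 2 * (cmod (f z))\<^sup>2 + 2 * (cmod (g z))\<^sup>2)"
    using assms by (auto simp: square_integrable_def)
  have "(cmod (a + b))\<^sup>2 \<le> 2 * (cmod a)\<^sup>2 + 2 * (cmod b)\<^sup>2" for a b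
  proof -
    have "(cmod (a + b))\<^sup>2 \<le> (cmod a + cmod b)\<^sup>2"
      by (intro power_mono norm_triangle_ineq) simp
    also have "\<dots> \<le> 2 * (cmod a)\<^sup>2 + 2 * (cmod b)\<^sup>2"
      using zero_le_power2[of "cmod a - cmod b"] by (simp add: power2_eq_square algebra_simps)
    finally show ?thesis .
  qed
  then show ?thesis
    unfolding square_integrable_def
    by (auto intro!: Bochner_Integration.integrable_bound[OF i])
qed

lemma square_integrable_scale:
  assumes "square_integrable f"
  shows "square_integrable (\<lambda>z. c * f z)"
  using assms by (auto simp: square_integrable_def norm_mult power_mult_distrib)

lemma square_integrable_Linfty_mult:
  assumes "\<psi> \<in> Linfty" "square_integrable f"
  shows "square_integrable (\<lambda>z. \<psi> z * f z)"
proof -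
  obtain B where B: "AE z in circle_measure. cmod (\<psi> z) \<le> B"
    and [measurable]: "\<psi> \<in> borel_measurable circle_measure"
    using assms by (auto simp: Linfty_def)
  have [measurable]: "f \<in> borel_measurable circle_measure"
    and i: "integrable circle_measure (\<lambda>z. B\<^sup>2 * (cmod (f z))\<^sup>2)"
    using assms by (auto simp: square_integrable_def)
  have "AE z in circle_measure. (cmod (\<psi> z * f z))\<^sup>2 \<le> B\<^sup>2 * (cmod (f z))\<^sup>2"
    using B by eventually_elim
      (auto simp: norm_mult power_mult_distrib intro!: mult_right_mono power_mono)
  then show ?thesis
    unfolding square_integrable_def
    by (auto intro!: Bochner_Integration.integrable_bound[OF i])
qed

lemma square_integrable_sharp:
  assumes "square_integrable f"
  shows "square_integrable (sharp f)"
proof -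
  have [measurable]: "f \<in> borel_measurable circle_measure"
    and i: "integrable circle_measure (\<lambda>z. (cmod (f z))\<^sup>2)"
    using assms by (auto simp: square_integrable_def)
  have [measurable]: "cnj \<in> borel_measurable (borel :: complex measure)"
    by (intro borel_measurable_continuous_onI continuous_intros)
  have "integrable (distr circle_measure circle_measure cnj) (\<lambda>z. (cmod (f z))\<^sup>2)"
    using i by (simp add: distr_cnj_circle_measure)
  then have "integrable circle_measure (\<lambda>z. (cmod (f (cnj z)))\<^sup>2)"
    by (subst (asm) integrable_distr_eq) auto
  then show ?thesis
    by (auto simp: square_integrable_def sharp_def)
qed

lemma square_integrable_integrable_mult:
  assumes "square_integrable f" "square_integrable g"
  shows "integrable circle_measure (\<lambda>z. f z * cnj (g z))"
proof -
  have [measurable]: "f \<in> borel_measurable circle_measure" "g \<in> borel_measurable circle_measure"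
    and i: "integrable circle_measure (\<lambda>z. (cmod (f z))\<^sup>2 + (cmod (g z))\<^sup>2)"
    using assms by (auto simp: square_integrable_def)
  have [measurable]: "cnj \<in> borel_measurable (borel :: complex measure)"
    by (intro borel_measurable_continuous_onI continuous_intros)
  have "cmod a * cmod b \<le> (cmod a)\<^sup>2 + (cmod b)\<^sup>2" for a b
  proof -
    have "0 \<le> cmod a * cmod b" by simp
    then show ?thesis
      using zero_le_power2[of "cmod a - cmod b"] unfolding power2_diff by linarith
  qed
  then show ?thesis
    by (auto intro!: Bochner_Integration.integrable_bound[OF i] simp: norm_mult)
qed

quotient_type L2_circle = "complex \<Rightarrow> complex" / partial:
  "\<lambda>f g. square_integrable f \<and> square_integrable g \<and> (AE z in circle_measure. f z = g z)"
proof (rule part_equivpI)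
  show "\<exists>f. square_integrable f \<and> square_integrable f \<and> (AE z in circle_measure. f z = f z)"
    by (intro exI[of _ "\<lambda>_. 0"]) (simp add: square_integrable_def)
  show "symp (\<lambda>f g. square_integrable f \<and> square_integrable g \<and>
      (AE z in circle_measure. f z = g z))"
    by (auto simp: symp_def elim!: eventually_mono)
  show "transp (\<lambda>f g. square_integrable f \<and> square_integrable g \<and>
      (AE z in circle_measure. f z = g z))"
    by (auto simp: transp_def elim: eventually_elim2)
qed

instantiation L2_circle :: complex_inner
begin

lift_definition zero_L2_circle :: L2_circle is "\<lambda>_. 0"
  by (simp add: square_integrable_def)

lift_definition plus_L2_circle :: "L2_circle \<Rightarrow> L2_circle \<Rightarrow> L2_circle"
  is "\<lambda>f g z. f z + g z"
  by (auto simp: square_integrable_add elim: eventually_elim2)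

lift_definition scaleC_L2_circle :: "complex \<Rightarrow> L2_circle \<Rightarrow> L2_circle"
  is "\<lambda>c f z. c * f z"
  by (auto simp: square_integrable_scale elim: eventually_mono)

lift_definition cinner_L2_circle :: "L2_circle \<Rightarrow> L2_circle \<Rightarrow> complex"
  is "\<lambda>f g. \<integral>z. f z * cnj (g z) \<partial>circle_measure"
proof -
  fix f f' g g'
  assume f: "square_integrable f \<and> square_integrable f' \<and> (AE z in circle_measure. f z = f' z)"
    and g: "square_integrable g \<and> square_integrable g' \<and> (AE z in circle_measure. g z = g' z)"
  have "AE z in circle_measure. f z * cnj (g z) = f' z * cnj (g' z)"
    using f g by (auto elim: eventually_elim2)
  then show "(\<integral>z. f z * cnj (g z) \<partial>circle_measure) = (\<integral>z. f' z * cnj (g' z) \<partial>circle_measure)"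
    using f g
    by (intro integral_cong_AE) (auto dest: square_integrable_integrable_mult)
qed

definition uminus_L2_circle :: "L2_circle \<Rightarrow> L2_circle" where
  "- f = (-1) *\<^sub>C (f :: L2_circle)"

definition minus_L2_circle :: "L2_circle \<Rightarrow> L2_circle \<Rightarrow> L2_circle" where
  "f - g = f + - (g :: L2_circle)"

definition scaleR_L2_circle :: "real \<Rightarrow> L2_circle \<Rightarrow> L2_circle" where
  "r *\<^sub>R f = complex_of_real r *\<^sub>C (f :: L2_circle)"

definition inner_L2_circle :: "L2_circle \<Rightarrow> L2_circle \<Rightarrow> real" where
  "inner f g = Re (cinner f (g :: L2_circle))"

definition norm_L2_circle :: "L2_circle \<Rightarrow> real" where
  "norm f = sqrt (inner f (f :: L2_circle))"

definition sgn_L2_circle :: "L2_circle \<Rightarrow> L2_circle" where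
  "sgn f = inverse (norm f) *\<^sub>R (f :: L2_circle)"

definition dist_L2_circle :: "L2_circle \<Rightarrow> L2_circle \<Rightarrow> real" where
  "dist f g = norm (f - (g :: L2_circle))"

definition uniformity_L2_circle :: "(L2_circle \<times> L2_circle) filter" where
  "uniformity_L2_circle = (INF e\<in>{0<..}. principal {(f :: L2_circle, g). dist f g < e})"

definition open_L2_circle :: "L2_circle set \<Rightarrow> bool" where
  "open_L2_circle U \<longleftrightarrow> (\<forall>f\<in>U. eventually (\<lambda>(f' :: L2_circle, g). f' = f \<longrightarrow> g \<in> U) uniformity)"

instance
proof
  fix f g h :: L2_circle and c d :: complex and r s :: real and U :: "L2_circle set"
  show "f + g + h = f + (g + h)"
    by transfer (auto simp: add.assoc intro!: square_integrable_add)
  show "f + g = g + f"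
    by transfer (auto simp: add.commute intro!: square_integrable_add)
  show "0 + f = f"
    by transfer auto
  show "- f + f = 0"
    unfolding uminus_L2_circle_def
    by transfer (auto simp: square_integrable_def)
  show "f - g = f + - g"
    by (fact minus_L2_circle_def)
  show scC_add: "c *\<^sub>C (f + g) = c *\<^sub>C f + c *\<^sub>C g" for c and f g :: L2_circle
    by transfer (auto simp: distrib_left
        intro!: square_integrable_add square_integrable_scale
        dest: square_integrable_scale square_integrable_add)
  show scC_addl: "(c + d) *\<^sub>C f = c *\<^sub>C f + d *\<^sub>C f" for c d and f :: L2_circle
    by transfer (auto simp: distrib_right
        intro!: square_integrable_add square_integrable_scale)
  show scC_scC: "c *\<^sub>C d *\<^sub>C f = (c * d) *\<^sub>C f" for c d and f :: L2_circle
    by transfer (auto simp: mult.assoc intro!: square_integrable_scale)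
  show "complex_of_real r *\<^sub>C f = r *\<^sub>R f"
    by (simp add: scaleR_L2_circle_def)
  show "r *\<^sub>R (f + g) = r *\<^sub>R f + r *\<^sub>R g"
    by (simp add: scaleR_L2_circle_def scC_add)
  show "(r + s) *\<^sub>R f = r *\<^sub>R f + s *\<^sub>R f"
    by (simp add: scaleR_L2_circle_def scC_addl)
  show "r *\<^sub>R s *\<^sub>R f = (r * s) *\<^sub>R f"
    by (simp add: scaleR_L2_circle_def scC_scC)
  show "1 *\<^sub>R f = f"
    unfolding scaleR_L2_circle_def by transfer auto
  show "sgn f = inverse (norm f) *\<^sub>R f"
    by (fact sgn_L2_circle_def)
  show "dist f g = norm (f - g)"
    by (fact dist_L2_circle_def)
  show "uniformity = (INF e\<in>{0<..}. principal {(f :: L2_circle, g). dist f g < e})"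
    by (fact uniformity_L2_circle_def)
  show "open U \<longleftrightarrow> (\<forall>f\<in>U. eventually (\<lambda>(f', g). f' = f \<longrightarrow> g \<in> U) uniformity)"
    by (fact open_L2_circle_def)
  show commute: "cinner f g = cnj (cinner g f)" for f g :: L2_circle
  proof transfer
    fix f g :: "complex \<Rightarrow> complex"
    show "(\<integral>z. f z * cnj (g z) \<partial>circle_measure) = cnj (\<integral>z. g z * cnj (f z) \<partial>circle_measure)"
      unfolding Bochner_Integration.integral_cnj[symmetric] by (simp add: mult.commute)
  qed
  show add: "cinner (f + g) h = cinner f h + cinner g h" for f g h :: L2_circle
    by transfer (auto simp: distrib_right square_integrable_integrable_mult)
  show scale: "cinner (c *\<^sub>C f) g = c * cinner f g" for c and f g :: L2_circle
    by transfer (auto simp: mult.assoc)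
  show "Re (cinner f g) = inner f g"
    by (simp add: inner_L2_circle_def)
  show "inner f g = inner g f"
    unfolding inner_L2_circle_def by (subst commute) simp
  show "inner (f + g) h = inner f h + inner g h"
    by (simp add: inner_L2_circle_def add)
  show "inner (r *\<^sub>R f) g = r * inner f g"
    by (simp add: inner_L2_circle_def scaleR_L2_circle_def scale)
  have inner_eq: "Re (\<integral>z. f z * cnj (f z) \<partial>circle_measure) =
      (\<integral>z. (cmod (f z))\<^sup>2 \<partial>circle_measure)" for f
    by (simp add: complex_mult_cnj cmod_power2 flip: of_real_power of_real_add)
  show "0 \<le> inner f f"
    unfolding inner_L2_circle_def
    by transfer (simp add: inner_eq)
  show "inner f f = 0 \<longleftrightarrow> f = 0"
    unfolding inner_L2_circle_def
  proof transfer
    fix f assume "square_integrable f \<and> square_integrable f \<and> (AE z in circle_measure. f z = f z)"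
    then show "Re (\<integral>z. f z * cnj (f z) \<partial>circle_measure) = 0 \<longleftrightarrow>
        square_integrable f \<and> square_integrable (\<lambda>_. 0) \<and> (AE z in circle_measure. f z = 0)"
      unfolding inner_eq
      by (subst integral_nonneg_eq_0_iff_AE) (auto simp: square_integrable_def)
  qed
  show "norm f = sqrt (inner f f)"
    by (fact norm_L2_circle_def)
qed

end

text \<open>The multiplication operator is only meant for \<open>\<psi> \<in> Linfty\<close> (otherwise it is the zero map).\<close>

lift_definition mult_op :: "(complex \<Rightarrow> complex) \<Rightarrow> L2_circle \<Rightarrow> L2_circle"
  is "\<lambda>\<psi> f z. if \<psi> \<in> Linfty then \<psi> z * f z else 0"
  subgoal for \<psi> f g
    by (cases "\<psi> \<in> Linfty")
       (auto simp: square_integrable_Linfty_mult square_integrable_def[of "\<lambda>_. 0"]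
         elim: eventually_mono)
  done

lift_definition J_star :: "L2_circle \<Rightarrow> L2_circle" is sharp
proof -
  fix f g
  assume *: "square_integrable f \<and> square_integrable g \<and> (AE z in circle_measure. f z = g z)"
  then have "AE z in circle_measure. f (cnj z) = g (cnj z)"
    by (intro AE_circle_cnj) simp
  then have "AE z in circle_measure. sharp f z = sharp g z"
    by eventually_elim (simp add: sharp_def)
  with * show "square_integrable (sharp f) \<and> square_integrable (sharp g) \<and>
      (AE z in circle_measure. sharp f z = sharp g z)"
    by (simp add: square_integrable_sharp)
qed

abbreviation M_z :: "L2_circle \<Rightarrow> L2_circle" where
  "M_z \<equiv> mult_op (\<lambda>z. z)"

lemma id_in_Linfty: "(\<lambda>z. z) \<in> Linfty"
  by (auto simp: Linfty_def measurable_restrict_space1 sets_circle_measure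
      cong: measurable_cong_sets intro!: exI[of _ 1] AE_I2)

definition bold_M_z :: "L2_circle \<times> L2_circle \<Rightarrow> L2_circle \<times> L2_circle" where
  "bold_M_z = block_operator M_z (\<lambda>_. 0) (\<lambda>_. 0) M_z"

end

theory Submission
  imports Defs
begin

text \<open>
  The conjugation \<open>J_star\<close> commutes with the shift \<open>M_z\<close>, because \<open>f \<mapsto> f\<^sup>#\<close> fixes the coordinate
  function. Hence an antilinear operator \<open>D\<close> commutes with \<open>M_z\<close> exactly when the linear operator
  \<open>D \<circ> J_star\<close> does, and a bounded linear operator commuting with \<open>M_z\<close> is multiplication by an
  \<open>L\<^sup>\<infinity>\<close> function (lemma \<open>T_eq_mult_op\<close>). So commutation with \<open>bold_M_z\<close> forces
  \<open>D\<^sub>i = M\<^bsub>\<psi>\<^sub>i\<^esub> J_star\<close>, and what remains is to read off what being a conjugation means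
  for the symbols.

  A conjugation is an antilinear involution \<open>C\<close> that is symmetric,
  \<open>\<langle>Cx, y\<rangle> = \<langle>Cy, x\<rangle>\<close> (lemma \<open>conjugation_iff_symmetric\<close>). The substitution \<open>z \<mapsto> cnj z\<close>, which preserves
  the measure, shows that the antilinear adjoint of \<open>M\<^sub>\<psi> J_star\<close> is the operator of the same form
  with the reflected symbol \<open>\<psi>(cnj z)\<close>. Symmetry of the block operator therefore says that
  \<open>\<psi>\<^sub>1\<close> and \<open>\<psi>\<^sub>4\<close> are invariant under reflection, which is the condition
  \<open>\<psi>\<^sup># = cnj \<psi>\<close>. Since \<open>M\<^sub>\<phi> J_star M\<^sub>\<psi> J_star\<close> is multiplication by \<open>\<phi> \<psi>\<^sup>#\<close>, the square of the
  block operator is a matrix of multiplication operators, and it is the identity iff four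
  pointwise equations hold. For reflection-invariant \<open>\<psi>\<^sub>1\<close>, \<open>\<psi>\<^sub>4\<close> the diagonal ones
  are the equations for the moduli, and the two off-diagonal ones are equivalent to each other
  and to the orthogonality relation.

  For the description of the commutant, consider all \<open>\<phi> \<in> L\<^sup>\<infinity>\<close> such that \<open>T\<close> commutes with
  multiplication by \<open>\<phi>\<close>. They form an algebra closed under bounded pointwise limits. It contains
  \<open>z\<close> and its inverse \<open>cnj z\<close>, hence all polynomials in \<open>Re z\<close> and \<open>Im z\<close>, hence by
  Stone--Weierstrass all continuous functions, hence the indicators of closed and then of all
  Borel sets. With \<open>\<psi> = T 1\<close> it follows that \<open>T s = \<psi> s\<close> for simple functions \<open>s\<close>; testing on
  \<open>{|\<psi>| > K}\<close>, where \<open>K\<close> bounds \<open>T\<close>, gives \<open>|\<psi>| \<le> K\<close>, and simple functions are dense.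
\<close>

section \<open>Square-integrable functions and their classes\<close>

lemma abs_L2_circle_eq_iff:
  assumes "square_integrable f" "square_integrable g"
  shows "abs_L2_circle f = abs_L2_circle g \<longleftrightarrow> (AE z in circle_measure. f z = g z)"
  using Quotient_rel[OF Quotient_L2_circle, of f g] assms by auto

lemma L2_circle_cases:
  obtains f where "square_integrable f" "x = abs_L2_circle f"
  using L2_circle.abs_induct[of "\<lambda>x. \<exists>f. square_integrable f \<and> x = abs_L2_circle f" x] by auto

lemma mult_op_abs:
  assumes "\<psi> \<in> Linfty" "square_integrable f"
  shows "mult_op \<psi> (abs_L2_circle f) = abs_L2_circle (\<lambda>z. \<psi> z * f z)"
  using assms by (simp add: mult_op.abs_eq)

lemma J_star_abs: "square_integrable f \<Longrightarrow> J_star (abs_L2_circle f) = abs_L2_circle (sharp f)"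
  by (simp add: J_star.abs_eq)

lemma add_abs:
  assumes "square_integrable f" "square_integrable g"
  shows "abs_L2_circle f + abs_L2_circle g = abs_L2_circle (\<lambda>z. f z + g z)"
  using assms by (simp add: plus_L2_circle.abs_eq)

lemma scaleC_abs:
  "square_integrable f \<Longrightarrow> c *\<^sub>C abs_L2_circle f = abs_L2_circle (\<lambda>z. c * f z)"
  by (simp add: scaleC_L2_circle.abs_eq)

lemma cinner_abs:
  assumes "square_integrable f" "square_integrable g"
  shows "cinner (abs_L2_circle f) (abs_L2_circle g) = (\<integral>z. f z * cnj (g z) \<partial>circle_measure)"
  using assms by (simp add: cinner_L2_circle.abs_eq)

lemma diff_abs:
  assumes "square_integrable f" "square_integrable g"
  shows "abs_L2_circle f - abs_L2_circle g = abs_L2_circle (\<lambda>z. f z - g z)"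
  using add_abs[OF assms(1) square_integrable_scale[OF assms(2), of "-1"]] assms
  by (simp add: minus_L2_circle_def uminus_L2_circle_def scaleC_abs)

lemma norm_abs:
  assumes "square_integrable f"
  shows "(norm (abs_L2_circle f))\<^sup>2 = (\<integral>z. (cmod (f z))\<^sup>2 \<partial>circle_measure)"
proof -
  have "(norm (abs_L2_circle f))\<^sup>2 = Re (\<integral>z. f z * cnj (f z) \<partial>circle_measure)"
    by (simp add: power2_norm_eq_inner flip: Re_cinner cinner_abs[OF assms assms])
  then show ?thesis
    by (simp add: complex_mult_cnj cmod_power2 flip: of_real_power of_real_add)
qed

lemma finite_measure_circle: "finite_measure circle_measure"
  by (rule finite_measureI) (simp add: prob_circle_measure del: space_circle_measure)

lemma Linfty_square_integrable:
  assumes "\<psi> \<in> Linfty"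
  shows "square_integrable \<psi>"
proof -
  interpret finite_measure circle_measure by (rule finite_measure_circle)
  have "square_integrable (\<lambda>z. \<psi> z * 1)"
    by (rule square_integrable_Linfty_mult[OF assms]) (simp add: square_integrable_def)
  then show ?thesis by simp
qed

lemma bounded_Linfty:
  assumes "\<psi> \<in> borel_measurable circle_measure" "\<And>z. z \<in> sphere 0 1 \<Longrightarrow> cmod (\<psi> z) \<le> B"
  shows "\<psi> \<in> Linfty"
  using assms by (auto simp: Linfty_def intro!: exI[of _ B] AE_I2)

lemma const_Linfty: "(\<lambda>_. c) \<in> Linfty"
  by (rule bounded_Linfty[of _ "cmod c"]) auto

lemma mult_Linfty:
  assumes "\<phi> \<in> Linfty" "\<psi> \<in> Linfty"
  shows "(\<lambda>z. \<phi> z * \<psi> z) \<in> Linfty"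
proof -
  from assms obtain A B where "AE z in circle_measure. cmod (\<phi> z) \<le> A"
    "AE z in circle_measure. cmod (\<psi> z) \<le> B" by (auto simp: Linfty_def)
  then have "AE z in circle_measure. cmod (\<phi> z * \<psi> z) \<le> A * B"
    by eventually_elim
      (auto simp: norm_mult intro!: mult_mono intro: order_trans[OF norm_ge_zero])
  with assms show ?thesis by (auto simp: Linfty_def)
qed

lemma add_Linfty:
  assumes "\<phi> \<in> Linfty" "\<psi> \<in> Linfty"
  shows "(\<lambda>z. \<phi> z + \<psi> z) \<in> Linfty"
proof -
  from assms obtain A B where "AE z in circle_measure. cmod (\<phi> z) \<le> A"
    "AE z in circle_measure. cmod (\<psi> z) \<le> B" by (auto simp: Linfty_def)
  then have "AE z in circle_measure. cmod (\<phi> z + \<psi> z) \<le> A + B"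
    by eventually_elim (rule order_trans[OF norm_triangle_ineq add_mono])
  with assms show ?thesis by (auto simp: Linfty_def)
qed

lemma reflect_Linfty:
  assumes "\<psi> \<in> Linfty"
  shows "(\<lambda>z. \<psi> (cnj z)) \<in> Linfty"
proof -
  from assms obtain B where "AE z in circle_measure. cmod (\<psi> z) \<le> B"
    and [measurable]: "\<psi> \<in> borel_measurable circle_measure" by (auto simp: Linfty_def)
  from AE_circle_cnj[OF this(1)] show ?thesis
    by (auto simp: Linfty_def)
qed

lemma cnj_borel_measurable [measurable]: "cnj \<in> borel_measurable borel"
  by (intro borel_measurable_continuous_onI continuous_intros)

lemma sharp_Linfty: "\<psi> \<in> Linfty \<Longrightarrow> sharp \<psi> \<in> Linfty"
  using reflect_Linfty[of \<psi>] by (auto simp: Linfty_def sharp_def)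

text \<open>
  This moves pointwise limits through bounded operators. It serves twice: for bounded limits of
  symbols, and for the approximation of an arbitrary element by simple functions.
\<close>

lemma L2_dominated_convergence:
  assumes F: "\<And>n. square_integrable (F n)" and f: "square_integrable f"
    and g: "square_integrable g"
    and lim: "AE z in circle_measure. (\<lambda>n. F n z) \<longlonglongrightarrow> f z"
    and bound: "\<And>n. AE z in circle_measure. cmod (F n z) \<le> cmod (g z)"
  shows "(\<lambda>n. abs_L2_circle (F n)) \<longlonglongrightarrow> abs_L2_circle f"
proof -
  have meas [measurable]: "F n \<in> borel_measurable circle_measure" "f \<in> borel_measurable circle_measure"
    "g \<in> borel_measurable circle_measure" for n
    using F f g by (auto simp: square_integrable_def)
  have all: "AE z in circle_measure. \<forall>n. cmod (F n z) \<le> cmod (g z)"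
    using bound by (simp add: AE_all_countable)
  have dom: "AE z in circle_measure. norm ((cmod (F n z - f z))\<^sup>2) \<le> 4 * (cmod (g z))\<^sup>2" for n
    using all lim
  proof eventually_elim
    case (elim z)
    have "cmod (f z) \<le> cmod (g z)"
      by (rule LIMSEQ_le_const2[OF tendsto_norm[OF elim(2)]]) (use elim(1) in auto)
    with elim(1) have "cmod (F n z - f z) \<le> 2 * cmod (g z)"
      using norm_triangle_ineq4[of "F n z" "f z"] by (smt (verit))
    then show ?case
      using power_mono[of "cmod (F n z - f z)" "2 * cmod (g z)" 2] by (simp add: power_mult_distrib)
  qed
  have conv: "AE z in circle_measure. (\<lambda>n. (cmod (F n z - f z))\<^sup>2) \<longlonglongrightarrow> 0"
    using lim
  proof eventually_elim
    case (elim z)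
    have "(\<lambda>n. (cmod (F n z - f z))\<^sup>2) \<longlonglongrightarrow> (cmod (f z - f z))\<^sup>2"
      by (intro tendsto_intros elim)
    then show ?case by simp
  qed
  have "(\<lambda>n. \<integral>z. (cmod (F n z - f z))\<^sup>2 \<partial>circle_measure) \<longlonglongrightarrow> (\<integral>z. 0 \<partial>circle_measure)"
    by (rule integral_dominated_convergence[OF _ _ _ conv dom])
      (use g in \<open>auto simp: square_integrable_def\<close>)
  moreover have "(norm (abs_L2_circle (F n) - abs_L2_circle f))\<^sup>2 =
      (\<integral>z. (cmod (F n z - f z))\<^sup>2 \<partial>circle_measure)" for n
  proof -
    have "square_integrable (\<lambda>z. F n z - f z)"
      using square_integrable_add[OF F square_integrable_scale[OF f, of "-1"]] by simp
    then show ?thesis by (simp add: diff_abs F f norm_abs)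
  qed
  ultimately have "(\<lambda>n. (norm (abs_L2_circle (F n) - abs_L2_circle f))\<^sup>2) \<longlonglongrightarrow> 0"
    by simp
  then have "(\<lambda>n. sqrt ((norm (abs_L2_circle (F n) - abs_L2_circle f))\<^sup>2)) \<longlonglongrightarrow> sqrt 0"
    by (rule tendsto_real_sqrt)
  then have "(\<lambda>n. norm (abs_L2_circle (F n) - abs_L2_circle f)) \<longlonglongrightarrow> 0"
    by simp
  then show ?thesis
    by (simp add: LIM_zero_iff tendsto_norm_zero_iff)
qed


section \<open>Multiplication operators\<close>

lemma mult_op_mult_op:
  assumes "\<phi> \<in> Linfty" "\<psi> \<in> Linfty"
  shows "mult_op \<phi> (mult_op \<psi> x) = mult_op (\<lambda>z. \<phi> z * \<psi> z) x"
proof -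
  obtain f where "square_integrable f" "x = abs_L2_circle f" by (rule L2_circle_cases)
  then show ?thesis
    using assms by (simp add: mult_op_abs mult_Linfty square_integrable_Linfty_mult mult.assoc)
qed

lemma mult_op_plus:
  assumes "\<phi> \<in> Linfty" "\<psi> \<in> Linfty"
  shows "mult_op (\<lambda>z. \<phi> z + \<psi> z) x = mult_op \<phi> x + mult_op \<psi> x"
proof -
  obtain f where "square_integrable f" "x = abs_L2_circle f" by (rule L2_circle_cases)
  then show ?thesis
    using assms
    by (simp add: mult_op_abs add_Linfty square_integrable_Linfty_mult add_abs distrib_right)
qed

lemma mult_op_add:
  assumes "\<psi> \<in> Linfty"
  shows "mult_op \<psi> (x + y) = mult_op \<psi> x + mult_op \<psi> y"
proof -
  obtain f where f: "square_integrable f" "x = abs_L2_circle f" by (rule L2_circle_cases)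
  obtain g where g: "square_integrable g" "y = abs_L2_circle g" by (rule L2_circle_cases)
  from f g show ?thesis using assms
    by (simp add: mult_op_abs add_abs square_integrable_add square_integrable_Linfty_mult
        distrib_left)
qed

lemma mult_op_const: "mult_op (\<lambda>_. c) x = c *\<^sub>C x"
proof -
  obtain f where "square_integrable f" "x = abs_L2_circle f" by (rule L2_circle_cases)
  then show ?thesis by (simp add: mult_op_abs const_Linfty scaleC_abs)
qed

lemma mult_op_scaleC:
  assumes "\<psi> \<in> Linfty"
  shows "mult_op \<psi> (c *\<^sub>C x) = c *\<^sub>C mult_op \<psi> x"
  by (simp add: mult_op_mult_op assms const_Linfty mult.commute flip: mult_op_const)

lemma mult_op_cong:
  assumes "\<phi> \<in> Linfty" "\<psi> \<in> Linfty" "AE z in circle_measure. \<phi> z = \<psi> z"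
  shows "mult_op \<phi> = mult_op \<psi>"
proof
  fix x
  obtain f where f: "square_integrable f" "x = abs_L2_circle f" by (rule L2_circle_cases)
  have "AE z in circle_measure. \<phi> z * f z = \<psi> z * f z"
    using assms(3) by eventually_elim simp
  with f assms show "mult_op \<phi> x = mult_op \<psi> x"
    by (simp add: mult_op_abs abs_L2_circle_eq_iff square_integrable_Linfty_mult)
qed

text \<open>A multiplication operator determines its symbol: apply it to the constant function \<open>1\<close>.\<close>

lemma mult_op_eq_iff:
  assumes "\<phi> \<in> Linfty" "\<psi> \<in> Linfty"
  shows "mult_op \<phi> = mult_op \<psi> \<longleftrightarrow> (AE z in circle_measure. \<phi> z = \<psi> z)"
proof
  assume "mult_op \<phi> = mult_op \<psi>"
  then have "mult_op \<phi> (abs_L2_circle (\<lambda>_. 1)) = mult_op \<psi> (abs_L2_circle (\<lambda>_. 1))"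
    by simp
  then show "AE z in circle_measure. \<phi> z = \<psi> z"
    using assms
    by (simp add: mult_op_abs const_Linfty abs_L2_circle_eq_iff Linfty_square_integrable)
qed (rule mult_op_cong[OF assms])

lemma mult_op_bounded_convergence:
  assumes F: "\<And>n. F n \<in> Linfty" and \<phi>: "\<phi> \<in> Linfty"
    and lim: "\<And>z. z \<in> sphere 0 1 \<Longrightarrow> (\<lambda>n. F n z) \<longlonglongrightarrow> \<phi> z"
    and bound: "\<And>n z. z \<in> sphere 0 1 \<Longrightarrow> cmod (F n z) \<le> B"
  shows "(\<lambda>n. mult_op (F n) x) \<longlonglongrightarrow> mult_op \<phi> x"
proof -
  obtain f where f: "square_integrable f" "x = abs_L2_circle f" by (rule L2_circle_cases)
  have "(\<lambda>n. abs_L2_circle (\<lambda>z. F n z * f z)) \<longlonglongrightarrow> abs_L2_circle (\<lambda>z. \<phi> z * f z)"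
  proof (rule L2_dominated_convergence)
    show "square_integrable (\<lambda>z. of_real B * f z)"
      by (rule square_integrable_scale[OF f(1)])
    show "AE z in circle_measure. (\<lambda>n. F n z * f z) \<longlonglongrightarrow> \<phi> z * f z"
      by (rule AE_I2) (auto intro!: tendsto_intros lim)
    show "AE z in circle_measure. cmod (F n z * f z) \<le> cmod (of_real B * f z)" for n
      by (rule AE_I2)
        (auto simp: norm_mult intro!: mult_right_mono order_trans[OF bound abs_ge_self])
  qed (auto intro!: square_integrable_Linfty_mult F \<phi> f)
  then show ?thesis by (simp add: f mult_op_abs F \<phi>)
qed


section \<open>The commutant of the bilateral shift\<close>

text \<open>
  \<open>bounded_linear\<close> provides only real linearity, so compatibility with complex scalars is
  a separate condition.
\<close>

locale shift_commuting =
  fixes T :: "L2_circle \<Rightarrow> L2_circle"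
  assumes T_bounded: "bounded_linear T"
    and T_scaleC: "T (c *\<^sub>C x) = c *\<^sub>C T x"
    and T_M_z: "T (M_z x) = M_z (T x)"
begin

definition commuting_symbols :: "(complex \<Rightarrow> complex) set" where
  "commuting_symbols = {\<phi> \<in> Linfty. \<forall>x. T (mult_op \<phi> x) = mult_op \<phi> (T x)}"

lemma T_add: "T (x + y) = T x + T y"
  using T_bounded by (rule linear_simps)

lemma commuting_Linfty: "\<phi> \<in> commuting_symbols \<Longrightarrow> \<phi> \<in> Linfty"
  by (simp add: commuting_symbols_def)

lemma commuting_const: "(\<lambda>_. c) \<in> commuting_symbols"
  by (simp add: commuting_symbols_def const_Linfty mult_op_const T_scaleC)

lemma commuting_add:
  assumes "\<phi> \<in> commuting_symbols" "\<psi> \<in> commuting_symbols"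
  shows "(\<lambda>z. \<phi> z + \<psi> z) \<in> commuting_symbols"
  using assms by (simp add: commuting_symbols_def add_Linfty mult_op_plus T_add)

lemma commuting_mult:
  assumes "\<phi> \<in> commuting_symbols" "\<psi> \<in> commuting_symbols"
  shows "(\<lambda>z. \<phi> z * \<psi> z) \<in> commuting_symbols"
  using assms by (simp add: commuting_symbols_def mult_Linfty flip: mult_op_mult_op)

lemma commuting_sum:
  "finite I \<Longrightarrow> (\<And>i. i \<in> I \<Longrightarrow> \<phi> i \<in> commuting_symbols) \<Longrightarrow>
    (\<lambda>z. \<Sum>i\<in>I. \<phi> i z) \<in> commuting_symbols"
  by (induction I rule: finite_induct) (auto intro: commuting_const commuting_add)

lemma commuting_id: "(\<lambda>z. z) \<in> commuting_symbols"
  by (simp add: commuting_symbols_def id_in_Linfty T_M_z)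

text \<open>On the circle \<open>cnj\<close> is the inverse of the coordinate, and inverses inherit commutation.\<close>

lemma commuting_cnj: "cnj \<in> commuting_symbols"
proof -
  have c: "cnj \<in> Linfty"
    using reflect_Linfty[OF id_in_Linfty] by simp
  have inv: "AE z in circle_measure. z * cnj z = 1"
    by (rule AE_I2) (simp add: complex_norm_square[symmetric])
  have M: "mult_op (\<lambda>z. z * cnj z) x = x" for x
    using mult_op_cong[OF mult_Linfty[OF id_in_Linfty c] const_Linfty inv]
    by (simp add: mult_op_const scaleC_of_real[of 1, simplified])
  have M': "mult_op cnj (M_z x) = x" "M_z (mult_op cnj x) = x" for x
    using M[of x] by (simp_all add: mult_op_mult_op c id_in_Linfty mult.commute)
  have "T (mult_op cnj x) = mult_op cnj (T x)" for x
    using T_M_z[of "mult_op cnj x"] M' by metis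
  with c show ?thesis by (simp add: commuting_symbols_def)
qed

text \<open>
  Dominated convergence makes both \<open>M\<^sub>\<phi> x\<close> and \<open>M\<^sub>\<phi> (T x)\<close> limits along the sequence, and \<open>T\<close> is
  continuous. In this form the lemma covers uniform limits of polynomials, cut-off functions
  decreasing to an indicator, and partial sums over a disjoint union.
\<close>

lemma commuting_limit:
  assumes F: "\<And>n. F n \<in> commuting_symbols"
    and lim: "\<And>z. z \<in> sphere 0 1 \<Longrightarrow> (\<lambda>n. F n z) \<longlonglongrightarrow> \<phi> z"
    and bound: "\<And>n z. z \<in> sphere 0 1 \<Longrightarrow> cmod (F n z) \<le> B"
  shows "\<phi> \<in> commuting_symbols"
proof -
  have FL: "F n \<in> Linfty" for n using F by (rule commuting_Linfty)
  have \<phi>: "\<phi> \<in> Linfty"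
  proof (rule bounded_Linfty)
    show "\<phi> \<in> borel_measurable circle_measure"
      by (rule borel_measurable_LIMSEQ_metric[of F]) (use FL lim in \<open>auto simp: Linfty_def\<close>)
    show "cmod (\<phi> z) \<le> B" if "z \<in> sphere 0 1" for z
      by (rule LIMSEQ_le_const2[OF tendsto_norm[OF lim[OF that]]]) (use bound that in auto)
  qed
  have "T (mult_op \<phi> x) = mult_op \<phi> (T x)" for x
  proof (rule LIMSEQ_unique)
    show "(\<lambda>n. T (mult_op (F n) x)) \<longlonglongrightarrow> T (mult_op \<phi> x)"
      by (rule bounded_linear.tendsto[OF T_bounded
            mult_op_bounded_convergence[OF FL \<phi> lim bound]])
    show "(\<lambda>n. T (mult_op (F n) x)) \<longlonglongrightarrow> mult_op \<phi> (T x)"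
      using mult_op_bounded_convergence[OF FL \<phi> lim bound, of "T x"] F
      by (simp add: commuting_symbols_def)
  qed
  with \<phi> show ?thesis by (simp add: commuting_symbols_def)
qed

lemma commuting_real_polynomial:
  fixes p :: "complex \<Rightarrow> real"
  assumes "real_polynomial_function p"
  shows "(\<lambda>z. complex_of_real (p z)) \<in> commuting_symbols"
  using assms
proof induction
  case (linear p)
  \<comment> \<open>Rewrite \<open>Re\<close> and \<open>Im\<close> in terms of \<open>z\<close> and \<open>cnj z\<close>.\<close>
  define a b where "a = (of_real (p 1) - \<i> * of_real (p \<i>)) / 2"
    and "b = (of_real (p 1) + \<i> * of_real (p \<i>)) / 2"
  have eq: "complex_of_real (p z) = a * z + b * cnj z" for z
  proof -
    have "p z = p (Re z *\<^sub>R 1 + Im z *\<^sub>R \<i>)"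
      by (rule arg_cong[where f = p]) (simp add: complex_eq_iff)
    also have "\<dots> = Re z * p 1 + Im z * p \<i>"
      using linear by (simp only: linear_simps real_scaleR_def)
    finally show ?thesis
      by (simp add: a_def b_def complex_eq_iff field_simps)
  qed
  show ?case
    unfolding eq
    by (intro commuting_add commuting_mult commuting_const commuting_id commuting_cnj)
next
  case (const c)
  show ?case by (rule commuting_const)
next
  case (add f g)
  then show ?case by (simp add: commuting_add)
next
  case (mult f g)
  then show ?case by (simp add: commuting_mult)
qed

lemma commuting_continuous:
  fixes h :: "complex \<Rightarrow> real"
  assumes h: "continuous_on (sphere 0 1) h"
  shows "(\<lambda>z. complex_of_real (h z)) \<in> commuting_symbols"
proof -
  have "\<exists>p. real_polynomial_function p \<and> (\<forall>z\<in>sphere 0 1. \<bar>h z - p z\<bar> < inverse (real (Suc n)))"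
    for n
    using Stone_Weierstrass_real_polynomial_function[OF compact_sphere h, of "inverse (real (Suc n))"]
    by (metis inverse_positive_iff_positive of_nat_0_less_iff zero_less_Suc)
  then obtain p where p: "\<And>n. real_polynomial_function (p n)"
    and approx: "\<And>n z. z \<in> sphere 0 1 \<Longrightarrow> \<bar>h z - p n z\<bar> < inverse (real (Suc n))"
    by metis
  obtain B where B: "\<And>z. z \<in> sphere 0 1 \<Longrightarrow> \<bar>h z\<bar> \<le> B"
    using compact_imp_bounded[OF compact_continuous_image[OF h compact_sphere]]
    by (metis bounded_iff image_eqI real_norm_def)
  show ?thesis
  proof (rule commuting_limit[where F = "\<lambda>n z. complex_of_real (p n z)" and B = "B + 1"])
    show "(\<lambda>z. complex_of_real (p n z)) \<in> commuting_symbols" for n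
      by (rule commuting_real_polynomial[OF p])
    show "(\<lambda>n. complex_of_real (p n z)) \<longlonglongrightarrow> complex_of_real (h z)" if z: "z \<in> sphere 0 1" for z
    proof (rule tendsto_of_real, rule LIMSEQ_I)
      fix e :: real assume "0 < e"
      then obtain N where "inverse (real (Suc N)) < e" using reals_Archimedean by blast
      have "norm (p n z - h z) < e" if "n \<ge> N" for n
      proof -
        have "\<bar>h z - p n z\<bar> < inverse (real (Suc n))" by (rule approx[OF z])
        also have "\<dots> \<le> inverse (real (Suc N))" using that by (simp add: field_simps)
        also have "\<dots> < e" by fact
        finally show ?thesis by (simp add: abs_minus_commute)
      qed
      then show "\<exists>N. \<forall>n\<ge>N. norm (p n z - h z) < e" by blast
    qed
    show "cmod (complex_of_real (p n z)) \<le> B + 1" if "z \<in> sphere 0 1" for n z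
    proof -
      have "inverse (real (Suc n)) \<le> 1" by (simp add: field_simps)
      with B[OF that] approx[OF that, of n] show ?thesis by (simp only: norm_of_real)
    qed
  qed
qed

text \<open>The functions \<open>max 0 (1 - n dist(z, F))\<close> are continuous and decrease to the indicator of \<open>F\<close>.\<close>

lemma commuting_indicator_closed:
  assumes "closed F"
  shows "(\<lambda>z. complex_of_real (indicator F z)) \<in> commuting_symbols"
proof (cases "F = {}")
  \<comment> \<open>\<open>infdist z {}\<close> is \<open>0\<close> by convention, so the cut-off functions would tend to \<open>1\<close> here.\<close>
  case True
  then show ?thesis using commuting_const[of 0] by simp
next
  case False
  let ?h = "\<lambda>n z. max 0 (1 - real n * infdist z F)"
  show ?thesis
  proof (rule commuting_limit[where F = "\<lambda>n z. complex_of_real (?h n z)" and B = 1])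
    show "(\<lambda>z. complex_of_real (?h n z)) \<in> commuting_symbols" for n
      by (intro commuting_continuous continuous_intros)
    show "cmod (complex_of_real (?h n z)) \<le> 1" for n z
      by (simp only: norm_of_real) (simp add: infdist_nonneg)
    show "(\<lambda>n. complex_of_real (?h n z)) \<longlonglongrightarrow> complex_of_real (indicator F z)" for z
    proof (rule tendsto_of_real, cases "z \<in> F")
      case True
      then show "(\<lambda>n. ?h n z) \<longlonglongrightarrow> indicator F z" by (simp add: max_def)
    next
      case False
      then have pos: "infdist z F > 0"
        using in_closed_iff_infdist_zero[OF assms \<open>F \<noteq> {}\<close>] infdist_nonneg[of z F]
        by (metis less_eq_real_def)
      then obtain N where N: "1 < real N * infdist z F" using reals_Archimedean3 by blast
      have "?h n z = 0" if "n \<ge> N" for n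
      proof -
        have "real N * infdist z F \<le> real n * infdist z F"
          using that pos by (intro mult_right_mono) auto
        with N show ?thesis by simp
      qed
      then have "eventually (\<lambda>n. ?h n z = indicator F z) sequentially"
        using False by (auto simp: eventually_sequentially)
      then show "(\<lambda>n. ?h n z) \<longlonglongrightarrow> indicator F z" by (rule tendsto_eventually)
    qed
  qed
qed

text \<open>
  Complements and disjoint unions stay within the commuting symbols, but intersections of
  arbitrary Borel sets are not directly accessible; closed sets being stable under
  intersection, Dynkin's theorem reaches all Borel sets.
\<close>

lemma commuting_indicator:
  assumes "A \<in> sets borel"
  shows "(\<lambda>z. complex_of_real (indicator A z)) \<in> commuting_symbols"
proof -
  have "Int_stable (Collect closed :: complex set set)"
    by (auto simp: Int_stable_def)
  moreover have "Collect closed \<subseteq> Pow (UNIV :: complex set)"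
    by simp
  moreover have "A \<in> sigma_sets UNIV (Collect closed)"
    using assms by (simp add: borel_eq_closed)
  ultimately show ?thesis
  proof (induction rule: sigma_sets_induct_disjoint)
    case (basic A)
    then show ?case by (simp add: commuting_indicator_closed)
  next
    case empty
    show ?case using commuting_const[of 0] by simp
  next
    case (compl A)
    have "(\<lambda>z. 1 + (-1) * complex_of_real (indicator A z)) \<in> commuting_symbols"
      by (intro commuting_add commuting_mult commuting_const compl)
    then show ?case by (simp add: indicator_diff)
  next
    case (union A)
    have sums: "(\<lambda>i. indicator (A i) z :: real) sums indicator (\<Union>i. A i) z" for z
      by (rule indicator_sums) (use union in \<open>auto simp: disjoint_family_on_def\<close>)
    show ?case
    proof (rule commuting_limit[where F = "\<lambda>n z. \<Sum>i<n. complex_of_real (indicator (A i) z)" and B = 1])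
      show "(\<lambda>z. \<Sum>i<n. complex_of_real (indicator (A i) z)) \<in> commuting_symbols" for n
        by (rule commuting_sum) (auto intro: union)
      show "(\<lambda>n. \<Sum>i<n. complex_of_real (indicator (A i) z)) \<longlonglongrightarrow>
          complex_of_real (indicator (\<Union>i. A i) z)" for z
        using tendsto_of_real[OF sums[of z, unfolded sums_def]] by simp
      show "cmod (\<Sum>i<n. complex_of_real (indicator (A i) z)) \<le> 1" for n z
      proof -
        have "(\<Sum>i<n. indicator (A i) z :: real) \<le> indicator (\<Union>i. A i) z"
          using sum_le_suminf[of "\<lambda>i. indicator (A i) z :: real" "{..<n}"] sums[of z]
          by (auto simp: sums_iff)
        also have "\<dots> \<le> 1" by (rule indicator_le_1)
        finally have "\<bar>\<Sum>i<n. indicator (A i) z :: real\<bar> \<le> 1"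
          by (simp add: sum_nonneg)
        then show ?thesis by (simp flip: of_real_sum)
      qed
    qed
  qed
qed

lemma borel_of_circle_set:
  assumes "A \<in> sets circle_measure"
  shows "A \<in> sets borel"
  using assms by (simp add: sets_circle_measure sets_restrict_space_iff)

text \<open>
  The symbol can only be \<open>\<psi> = T 1\<close>. Multiplication by it agrees with \<open>T\<close> on every commuting symbol
  \<open>\<phi>\<close>, because \<open>T \<phi> = T (M\<^sub>\<phi> 1) = M\<^sub>\<phi> (T 1)\<close>. This first bounds \<open>\<psi>\<close> and then, by density of the
  simple functions, determines \<open>T\<close>.
\<close>

lemma T_eq_mult_op: "\<exists>\<psi>\<in>Linfty. T = mult_op \<psi>"
proof -
  let ?one = "abs_L2_circle (\<lambda>_. 1)"
  obtain \<psi> where \<psi>: "square_integrable \<psi>" and T_one: "T ?one = abs_L2_circle \<psi>"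
    by (rule L2_circle_cases)
  have [measurable]: "\<psi> \<in> borel_measurable circle_measure"
    using \<psi> by (simp add: square_integrable_def)
  have T_comm: "T (abs_L2_circle \<phi>) = abs_L2_circle (\<lambda>z. \<phi> z * \<psi> z)"
    if "\<phi> \<in> commuting_symbols" for \<phi>
  proof -
    have "\<phi> \<in> Linfty" using that by (rule commuting_Linfty)
    then have "T (abs_L2_circle \<phi>) = T (mult_op \<phi> ?one)"
      by (simp add: mult_op_abs Linfty_square_integrable const_Linfty)
    also have "\<dots> = mult_op \<phi> (abs_L2_circle \<psi>)"
      using that by (simp add: commuting_symbols_def T_one)
    finally show ?thesis using \<open>\<phi> \<in> Linfty\<close> \<psi> by (simp add: mult_op_abs)
  qed
  obtain K where K: "K > 0" "\<And>x. norm (T x) \<le> norm x * K"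
    using bounded_linear.pos_bounded[OF T_bounded] by blast
  have \<psi>_Linfty: "\<psi> \<in> Linfty"
  proof -
    let ?A = "{z \<in> sphere 0 1. K < cmod (\<psi> z)}"
    let ?\<phi> = "\<lambda>z. complex_of_real (indicator ?A z)"
    have A: "?A \<in> sets circle_measure"
      using measurable_sets[of "\<lambda>z. cmod (\<psi> z)" circle_measure borel "{K<..}"]
      by (simp add: vimage_def Int_def conj_commute)
    have \<phi>: "?\<phi> \<in> commuting_symbols"
      by (rule commuting_indicator[OF borel_of_circle_set[OF A]])
    have \<phi>_sq: "square_integrable ?\<phi>" and \<phi>\<psi>_sq: "square_integrable (\<lambda>z. ?\<phi> z * \<psi> z)"
      using Linfty_square_integrable[OF commuting_Linfty[OF \<phi>]]
        square_integrable_Linfty_mult[OF commuting_Linfty[OF \<phi>] \<psi>]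
      by blast+
    \<comment> \<open>\<open>?d\<close> is non-negative, and positive exactly on \<open>?A\<close>. Since \<open>K\<close> bounds \<open>T\<close>, its integral is at
      most \<open>0\<close>, so \<open>?A\<close> is a null set.\<close>
    let ?d = "\<lambda>z. (cmod (?\<phi> z * \<psi> z))\<^sup>2 - K\<^sup>2 * (cmod (?\<phi> z))\<^sup>2"
    have int: "integrable circle_measure ?d"
      using \<phi>_sq \<phi>\<psi>_sq by (auto simp: square_integrable_def)
    have "(norm (T (abs_L2_circle ?\<phi>)))\<^sup>2 \<le> (norm (abs_L2_circle ?\<phi>) * K)\<^sup>2"
      by (rule power_mono[OF K(2) norm_ge_zero])
    then have "(\<integral>z. (cmod (?\<phi> z * \<psi> z))\<^sup>2 \<partial>circle_measure) \<le>
        (\<integral>z. (cmod (?\<phi> z))\<^sup>2 \<partial>circle_measure) * K\<^sup>2"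
      unfolding T_comm[OF \<phi>] power_mult_distrib norm_abs[OF \<phi>_sq] norm_abs[OF \<phi>\<psi>_sq] .
    then have "integral\<^sup>L circle_measure ?d \<le> 0"
      using \<phi>_sq \<phi>\<psi>_sq by (simp add: square_integrable_def mult.commute)
    moreover have nonneg: "0 \<le> ?d z" for z
      using power_mono[of K "cmod (\<psi> z)" 2] K(1)
      by (auto simp: indicator_def)
    ultimately have "integral\<^sup>L circle_measure ?d = 0"
      using Bochner_Integration.integral_nonneg[of circle_measure ?d] by fastforce
    then have "AE z in circle_measure. ?d z = 0"
      using integral_nonneg_eq_0_iff_AE[OF int] nonneg by simp
    moreover have "AE z in circle_measure. z \<in> sphere 0 1"
      by (rule AE_I2) simp
    ultimately have "AE z in circle_measure. cmod (\<psi> z) \<le> K"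
    proof eventually_elim
      case (elim z)
      then show ?case
        using power_strict_mono[of K "cmod (\<psi> z)" 2] K(1)
        by (cases "K < cmod (\<psi> z)") auto
    qed
    then show ?thesis by (auto simp: Linfty_def)
  qed
  have "T x = mult_op \<psi> x" for x
  proof -
    obtain f where f: "square_integrable f" "x = abs_L2_circle f" by (rule L2_circle_cases)
    then have "f \<in> borel_measurable circle_measure" by (simp add: square_integrable_def)
    then obtain s where s: "\<And>n. simple_function circle_measure (s n)"
      and lim: "\<And>z. z \<in> space circle_measure \<Longrightarrow> (\<lambda>n. s n z) \<longlonglongrightarrow> f z"
      and bound: "\<And>n z. z \<in> space circle_measure \<Longrightarrow> dist (s n z) 0 \<le> 2 * dist (f z) 0"
      using borel_measurable_implies_sequence_metric[of f circle_measure 0] by blast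
    \<comment> \<open>\<open>r n\<close> is \<open>s n\<close> written through indicators of Borel sets, which commute with \<open>T\<close>. Both agree
      on the circle only, as \<open>r n\<close> vanishes elsewhere.\<close>
    define r where "r n z = (\<Sum>y\<in>s n ` sphere 0 1. 
        complex_of_real (indicator (s n -` {y} \<inter> sphere 0 1) z) * y)" for n z
    have r_eq: "r n z = s n z" if "z \<in> sphere 0 1" for n z
      using simple_function_indicator_representation_banach[OF s[of n], of z] that
      by (simp only: r_def scaleR_conv_of_real space_circle_measure)
    have r: "r n \<in> commuting_symbols" for n
      unfolding r_def
      using simple_functionD[OF s[of n]]
      by (intro commuting_sum commuting_mult commuting_const commuting_indicator borel_of_circle_set)
        auto
    have r_sq: "square_integrable (r n)" for n
      by (rule Linfty_square_integrable[OF commuting_Linfty[OF r]])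
    have "(\<lambda>n. abs_L2_circle (r n)) \<longlonglongrightarrow> x"
      unfolding f(2)
    proof (rule L2_dominated_convergence[where g = "\<lambda>z. 2 * f z"])
      show "AE z in circle_measure. (\<lambda>n. r n z) \<longlonglongrightarrow> f z"
        by (rule AE_I2) (use lim r_eq in auto)
      show "AE z in circle_measure. cmod (r n z) \<le> cmod (2 * f z)" for n
        by (rule AE_I2) (use bound r_eq in \<open>auto simp: norm_mult\<close>)
    qed (auto intro: r_sq f square_integrable_scale)
    then have "(\<lambda>n. T (abs_L2_circle (r n))) \<longlonglongrightarrow> T x"
      by (rule bounded_linear.tendsto[OF T_bounded])
    moreover have "(\<lambda>n. T (abs_L2_circle (r n))) \<longlonglongrightarrow> mult_op \<psi> x"
      unfolding f(2) T_comm[OF r] mult_op_abs[OF \<psi>_Linfty f(1)]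
    proof (rule L2_dominated_convergence[where g = "\<lambda>z. \<psi> z * (2 * f z)"])
      show "AE z in circle_measure. (\<lambda>n. r n z * \<psi> z) \<longlonglongrightarrow> \<psi> z * f z"
        by (rule AE_I2) (use lim r_eq in \<open>auto simp: mult.commute intro!: tendsto_intros\<close>)
      show "AE z in circle_measure. cmod (r n z * \<psi> z) \<le> cmod (\<psi> z * (2 * f z))" for n
        by (rule AE_I2)
          (use bound r_eq in \<open>auto simp: norm_mult mult.commute intro!: mult_left_mono\<close>)
    qed (auto intro!: square_integrable_Linfty_mult[OF \<psi>_Linfty] square_integrable_scale f
        square_integrable_Linfty_mult[OF commuting_Linfty[OF r]] \<psi>)
    ultimately show ?thesis by (rule LIMSEQ_unique)
  qed
  with \<psi>_Linfty show ?thesis by auto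
qed

end


section \<open>Antilinear operators and conjugations\<close>

lemma antilinear_zero: "antilinear A \<Longrightarrow> A 0 = 0"
proof -
  have zero: "0 *\<^sub>C x = 0" for x :: "'c::complex_inner"
    using scaleC_of_real[of 0 x] by simp
  show "antilinear A \<Longrightarrow> A 0 = 0"
    unfolding antilinear_def by (metis complex_cnj_zero zero)
qed

lemma cinner_eqI:
  assumes "\<And>f. cinner f x = cinner f (y :: 'a::complex_inner)"
  shows "x = y"
proof -
  have "f \<bullet> x = f \<bullet> y" for f
    using assms[of f] by (simp flip: Re_cinner)
  then show ?thesis using vector_eq_ldot by blast
qed

text \<open>
  An adjoint is determined by its inner products, so the definite description evaluates to any
  operator that satisfies the adjoint identity.
\<close>

lemma antilinear_adjoint_eqI:
  assumes "antilinear B" "\<And>f g. cinner (A f) g = cnj (cinner f (B g))"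
  shows "antilinear_adjoint A = B"
  unfolding antilinear_adjoint_def
proof (rule the_equality)
  show "antilinear B \<and> (\<forall>f g. cinner (A f) g = cnj (cinner f (B g)))"
    using assms by simp
next
  fix B' assume B': "antilinear B' \<and> (\<forall>f g. cinner (A f) g = cnj (cinner f (B' g)))"
  show "B' = B"
  proof
    fix g
    show "B' g = B g"
      by (rule cinner_eqI) (metis B' assms(2) complex_cnj_cancel_iff)
  qed
qed

text \<open>
  For an involution, replacing \<open>y\<close> by \<open>C y\<close> turns \<open>\<langle>Cx, Cy\<rangle> = \<langle>y, x\<rangle>\<close> into symmetry. Unlike the
  isometry condition, symmetry is linear in \<open>C\<close> and so can be checked entry by entry.
\<close>

lemma conjugation_iff_symmetric:
  "conjugation C \<longleftrightarrow>
    antilinear C \<and> C \<circ> C = id \<and> (\<forall>x y. cinner (C x) y = cinner (C y) x)"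
  unfolding conjugation_def by (metis comp_apply id_apply)

lemma cinner_add_right: "cinner x (y + z) = cinner x y + cinner x (z :: 'a::complex_inner)"
  by (metis cinner_commute cinner_add_left complex_cnj_add)

lemma cinner_zero [simp]: "cinner 0 (x :: 'a::complex_inner) = 0" "cinner x 0 = 0"
  using cinner_add_left[of 0 0 x] cinner_add_right[of x 0 0] by simp_all

lemma block_operator_symmetric_iff:
  fixes A :: "'a::complex_inner \<Rightarrow> 'a"
  assumes zero: "A 0 = 0" "B 0 = 0" "E 0 = 0" "D 0 = 0"
  shows "(\<forall>x y. cinner (block_operator A B E D x) y = cinner (block_operator A B E D y) x) \<longleftrightarrow>
    (\<forall>f g. cinner (A f) g = cinner (A g) f) \<and> (\<forall>f g. cinner (D f) g = cinner (D g) f) \<and>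
    (\<forall>f g. cinner (B f) g = cinner (E g) f)"
    (is "?sym \<longleftrightarrow> ?entries")
proof
  assume sym: ?sym
  have *: "cinner (A f + B g) h + cinner (E f + D g) k = cinner (A h + B k) f + cinner (E h + D k) g"
    for f g h k
    using sym[rule_format, of "(f, g)" "(h, k)"] by (simp add: block_operator_def cinner_prod_def)
  show ?entries
    using *[of _ 0 _ 0] *[of 0 _ 0 _] *[of 0 _ _ 0] by (simp add: zero)
next
  assume ?entries
  then show ?sym
    by (auto simp: block_operator_def cinner_prod_def cinner_add_left)
qed


section \<open>Weighted reflections\<close>

lemma J_star_J_star: "J_star (J_star x) = x"
proof -
  obtain f where "square_integrable f" "x = abs_L2_circle f" by (rule L2_circle_cases)
  moreover have "sharp (sharp f) = f" by (simp add: sharp_def)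
  ultimately show ?thesis by (simp add: J_star_abs square_integrable_sharp)
qed

lemma J_star_add: "J_star (x + y) = J_star x + J_star y"
proof -
  obtain f where f: "square_integrable f" "x = abs_L2_circle f" by (rule L2_circle_cases)
  obtain g where g: "square_integrable g" "y = abs_L2_circle g" by (rule L2_circle_cases)
  have "sharp (\<lambda>z. f z + g z) = (\<lambda>z. sharp f z + sharp g z)" by (simp add: sharp_def)
  with f g show ?thesis
    by (simp add: J_star_abs add_abs square_integrable_sharp square_integrable_add)
qed

lemma J_star_mult_op:
  assumes "\<psi> \<in> Linfty"
  shows "J_star (mult_op \<psi> x) = mult_op (sharp \<psi>) (J_star x)"
proof -
  obtain f where f: "square_integrable f" "x = abs_L2_circle f" by (rule L2_circle_cases)
  have "sharp (\<lambda>z. \<psi> z * f z) = (\<lambda>z. sharp \<psi> z * sharp f z)" by (simp add: sharp_def)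
  with f assms show ?thesis
    by (simp add: J_star_abs mult_op_abs square_integrable_Linfty_mult sharp_Linfty
        square_integrable_sharp)
qed

lemma J_star_scaleC: "J_star (c *\<^sub>C x) = cnj c *\<^sub>C J_star x"
  using J_star_mult_op[OF const_Linfty, of c x] by (simp add: mult_op_const sharp_def)

lemma J_star_M_z: "J_star (M_z x) = M_z (J_star x)"
  using J_star_mult_op[OF id_in_Linfty, of x] by (simp add: sharp_def)

lemma antilinear_weighted_reflection:
  assumes "\<psi> \<in> Linfty"
  shows "antilinear (mult_op \<psi> \<circ> J_star)"
  using assms by (simp add: antilinear_def J_star_add J_star_scaleC mult_op_add mult_op_scaleC)

text \<open>Substitute \<open>z \<mapsto> cnj z\<close> in the integral; the circle measure is invariant under it.\<close>

lemma cinner_weighted_reflection: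
  assumes \<psi>: "\<psi> \<in> Linfty"
  shows "cinner (mult_op \<psi> (J_star x)) y = cinner (mult_op (\<lambda>z. \<psi> (cnj z)) (J_star y)) x"
proof -
  obtain f where f: "square_integrable f" "x = abs_L2_circle f" by (rule L2_circle_cases)
  obtain g where g: "square_integrable g" "y = abs_L2_circle g" by (rule L2_circle_cases)
  have [measurable]: "\<psi> \<in> borel_measurable circle_measure" "f \<in> borel_measurable circle_measure"
    "g \<in> borel_measurable circle_measure"
    using f g \<psi> by (auto simp: square_integrable_def Linfty_def)
  have "(\<integral>z. \<psi> z * sharp f z * cnj (g z) \<partial>circle_measure) =
      (\<integral>z. \<psi> z * sharp f z * cnj (g z) \<partial>distr circle_measure circle_measure cnj)"
    by (simp only: distr_cnj_circle_measure)
  also have "\<dots> = (\<integral>z. \<psi> (cnj z) * sharp f (cnj z) * cnj (g (cnj z)) \<partial>circle_measure)"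
    by (rule integral_distr) (auto simp: sharp_def)
  also have "\<dots> = (\<integral>z. \<psi> (cnj z) * sharp g z * cnj (f z) \<partial>circle_measure)"
    by (simp add: sharp_def mult_ac)
  finally show ?thesis
    using f g \<psi>
    by (simp add: J_star_abs mult_op_abs square_integrable_sharp reflect_Linfty cinner_abs
        square_integrable_Linfty_mult)
qed

lemma weighted_reflection_adjoint_iff:
  assumes "\<phi> \<in> Linfty" "\<psi> \<in> Linfty"
  shows "(\<forall>x y. cinner (mult_op \<phi> (J_star x)) y = cinner (mult_op \<psi> (J_star y)) x) \<longleftrightarrow>
    (AE z in circle_measure. \<phi> (cnj z) = \<psi> z)"
    (is "?adj \<longleftrightarrow> ?symbols")
proof
  assume ?adj
  then have *: "cinner (mult_op (\<lambda>z. \<phi> (cnj z)) (J_star y)) x = cinner (mult_op \<psi> (J_star y)) x"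
    for x y
    using cinner_weighted_reflection[OF assms(1)] by metis
  have "mult_op (\<lambda>z. \<phi> (cnj z)) (J_star y) = mult_op \<psi> (J_star y)" for y
    by (rule cinner_eqI) (metis * cinner_commute)
  then have "mult_op (\<lambda>z. \<phi> (cnj z)) = mult_op \<psi>"
    by (metis J_star_J_star ext)
  then show ?symbols
    using mult_op_eq_iff[OF reflect_Linfty[OF assms(1)] assms(2)] by simp
next
  assume ?symbols
  then have "mult_op (\<lambda>z. \<phi> (cnj z)) = mult_op \<psi>"
    by (rule mult_op_cong[OF reflect_Linfty[OF assms(1)] assms(2)])
  then show ?adj
    using cinner_weighted_reflection[OF assms(1)] by simp
qed

lemma antilinear_adjoint_weighted_reflection:
  assumes "\<psi> \<in> Linfty"
  shows "antilinear_adjoint (mult_op \<psi> \<circ> J_star) = mult_op (\<lambda>z. \<psi> (cnj z)) \<circ> J_star"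
proof (rule antilinear_adjoint_eqI)
  show "antilinear (mult_op (\<lambda>z. \<psi> (cnj z)) \<circ> J_star)"
    by (rule antilinear_weighted_reflection[OF reflect_Linfty[OF assms]])
  show "cinner ((mult_op \<psi> \<circ> J_star) f) g =
      cnj (cinner f ((mult_op (\<lambda>z. \<psi> (cnj z)) \<circ> J_star) g))" for f g
    using cinner_weighted_reflection[OF assms, of f g] by (simp flip: cinner_commute)
qed

lemma weighted_reflection_compose:
  assumes "\<phi> \<in> Linfty" "\<psi> \<in> Linfty"
  shows "mult_op \<phi> (J_star (mult_op \<psi> (J_star x))) = mult_op (\<lambda>z. \<phi> z * sharp \<psi> z) x"
  using assms by (simp add: J_star_mult_op J_star_J_star mult_op_mult_op sharp_Linfty)

text \<open>
  The square is again a block matrix of multiplication operators, so it can be compared with the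
  identity entry by entry.
\<close>

lemma block_weighted_reflection_involution_iff:
  assumes [simp]: "a \<in> Linfty" "b \<in> Linfty" "e \<in> Linfty" "d \<in> Linfty"
  defines "C \<equiv> block_operator (mult_op a \<circ> J_star) (mult_op b \<circ> J_star)
    (mult_op e \<circ> J_star) (mult_op d \<circ> J_star)"
  shows "C \<circ> C = id \<longleftrightarrow>
    (AE z in circle_measure. a z * sharp a z + b z * sharp e z = 1) \<and>
    (AE z in circle_measure. a z * sharp b z + b z * sharp d z = 0) \<and>
    (AE z in circle_measure. e z * sharp a z + d z * sharp e z = 0) \<and>
    (AE z in circle_measure. e z * sharp b z + d z * sharp d z = 1)"
proof -
  define p q r s where "p = (\<lambda>z. a z * sharp a z + b z * sharp e z)"
    and "q = (\<lambda>z. a z * sharp b z + b z * sharp d z)"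
    and "r = (\<lambda>z. e z * sharp a z + d z * sharp e z)"
    and "s = (\<lambda>z. e z * sharp b z + d z * sharp d z)"
  note pqrs_def = p_def q_def r_def s_def
  have [simp]: "p \<in> Linfty" "q \<in> Linfty" "r \<in> Linfty" "s \<in> Linfty"
    by (simp_all add: pqrs_def add_Linfty mult_Linfty sharp_Linfty)
  have CC: "C (C (x, y)) = (mult_op p x + mult_op q y, mult_op r x + mult_op s y)" for x y
    by (simp add: C_def block_operator_def J_star_add mult_op_add weighted_reflection_compose
        pqrs_def mult_op_plus mult_Linfty sharp_Linfty add_ac)
  have one: "mult_op (\<lambda>_. 1) x = x" and zero: "mult_op (\<lambda>_. 0) x = 0" for x
    using scaleC_of_real[of 1 x] scaleC_of_real[of 0 x] by (simp_all add: mult_op_const)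
  have mult_zero: "mult_op \<phi> 0 = 0" if "\<phi> \<in> Linfty" for \<phi>
    using mult_op_add[OF that, of 0 0] by simp
  have "C \<circ> C = id \<longleftrightarrow> mult_op p = mult_op (\<lambda>_. 1) \<and> mult_op q = mult_op (\<lambda>_. 0) \<and>
      mult_op r = mult_op (\<lambda>_. 0) \<and> mult_op s = mult_op (\<lambda>_. 1)" (is "_ \<longleftrightarrow> ?entries")
  proof
    assume "C \<circ> C = id"
    then have "C (C (x, y)) = (x, y)" for x y by (metis comp_apply id_apply)
    then have eq: "mult_op p x + mult_op q y = x" "mult_op r x + mult_op s y = y" for x y
      by (simp_all only: CC prod.inject)
    from eq[of _ 0] eq[of 0] show ?entries
      by (simp add: fun_eq_iff mult_zero one zero)
  next
    assume ?entries
    then show "C \<circ> C = id"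
      by (auto simp: fun_eq_iff CC one zero)
  qed
  also have "\<dots> \<longleftrightarrow> (AE z in circle_measure. p z = 1) \<and> (AE z in circle_measure. q z = 0) \<and>
      (AE z in circle_measure. r z = 0) \<and> (AE z in circle_measure. s z = 1)"
    by (simp add: mult_op_eq_iff const_Linfty)
  finally show ?thesis by (simp add: pqrs_def)
qed

text \<open>
  Composing with the isometric involution \<open>J_star\<close>, which commutes with \<open>M_z\<close>, reduces the
  antilinear case to the linear commutant.
\<close>

lemma shift_commuting_antilinear:
  assumes D: "bounded_antilinear D" and comm: "\<And>x. D (M_z x) = M_z (D x)"
  shows "\<exists>\<psi>\<in>Linfty. D = mult_op \<psi> \<circ> J_star"
proof -
  have anti: "antilinear D" using D by (simp add: bounded_antilinear_def)
  obtain K where K: "\<And>x. norm (D x) \<le> norm x * K"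
    using D by (auto simp: bounded_antilinear_def)
  have norm_J: "norm (J_star x) = norm x" for x
  proof -
    have "cinner (J_star x) (J_star x) = cinner x x"
      using cinner_weighted_reflection[OF const_Linfty, of 1 x "J_star x"]
        scaleC_of_real[of 1 "J_star x"] scaleC_of_real[of 1 x]
      by (simp add: mult_op_const J_star_J_star)
    then show ?thesis
      by (simp add: norm_eq_sqrt_inner flip: Re_cinner)
  qed
  interpret shift_commuting "D \<circ> J_star"
  proof (rule shift_commuting.intro)
    have scale: "(D \<circ> J_star) (c *\<^sub>C x) = c *\<^sub>C (D \<circ> J_star) x" for c x
      using anti by (simp add: antilinear_def J_star_scaleC)
    then show "(D \<circ> J_star) (c *\<^sub>C x) = c *\<^sub>C (D \<circ> J_star) x" for c x .
    show "bounded_linear (D \<circ> J_star)"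
    proof (rule bounded_linear_intro)
      show "(D \<circ> J_star) (x + y) = (D \<circ> J_star) x + (D \<circ> J_star) y" for x y
        using anti by (simp add: antilinear_def J_star_add)
      show "(D \<circ> J_star) (r *\<^sub>R x) = r *\<^sub>R (D \<circ> J_star) x" for r x
        using scale[of "of_real r" x] by (simp only: scaleC_of_real)
      show "norm ((D \<circ> J_star) x) \<le> norm x * K" for x
        using K[of "J_star x"] by (simp add: norm_J)
    qed
    show "(D \<circ> J_star) (M_z x) = M_z ((D \<circ> J_star) x)" for x
      by (simp add: J_star_M_z comm)
  qed
  from T_eq_mult_op obtain \<psi> where "\<psi> \<in> Linfty" "D \<circ> J_star = mult_op \<psi>" by blast
  then show ?thesis
    by (metis J_star_J_star comp_apply ext)
qed


section \<open>Conjugations commuting with the shift\<close>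

text \<open>
  Symmetry accounts for the first two conditions. Given these, \<open>C \<circ> C = id\<close> amounts to four equations:
  the upper diagonal one gives \<open>|\<psi>\<^sub>1|\<^sup>2 = 1 - |\<psi>\<^sub>2|\<^sup>2\<close>, the lower one the same for \<open>\<psi>\<^sub>4\<close> at the
  reflected point, and each off-diagonal one is the last condition up to reflection and
  conjugation.
\<close>

lemma block_weighted_reflection_conjugation_iff:
  assumes [simp]: "\<psi>1 \<in> Linfty" "\<psi>2 \<in> Linfty" "\<psi>4 \<in> Linfty"
    and C: "antilinear C"
    and C_def: "C = block_operator (mult_op \<psi>1 \<circ> J_star) (mult_op \<psi>2 \<circ> J_star)
      (mult_op (\<lambda>z. \<psi>2 (cnj z)) \<circ> J_star) (mult_op \<psi>4 \<circ> J_star)"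
  shows "conjugation C \<longleftrightarrow>
       (AE z in circle_measure. sharp \<psi>1 z = cnj (\<psi>1 z)) \<and>
       (AE z in circle_measure. sharp \<psi>4 z = cnj (\<psi>4 z)) \<and>
       (AE z in circle_measure. (cmod (\<psi>1 z))\<^sup>2 = (cmod (\<psi>4 z))\<^sup>2) \<and>
       (AE z in circle_measure. (cmod (\<psi>4 z))\<^sup>2 = 1 - (cmod (\<psi>2 z))\<^sup>2) \<and>
       (AE z in circle_measure. sharp \<psi>1 z * \<psi>2 z + sharp \<psi>2 z * \<psi>4 z = 0)"
    (is "_ \<longleftrightarrow> ?s1 \<and> ?s4 \<and> ?m1 \<and> ?m4 \<and> ?o")
proof -
  have [simp]: "(\<lambda>z. \<psi>2 (cnj z)) \<in> Linfty"
    by (rule reflect_Linfty) simp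
  have zero: "(mult_op \<psi> \<circ> J_star) 0 = 0" if "\<psi> \<in> Linfty" for \<psi>
    by (rule antilinear_zero[OF antilinear_weighted_reflection[OF that]])
  have symmetric: "(\<forall>x y. cinner (C x) y = cinner (C y) x) \<longleftrightarrow> ?s1 \<and> ?s4"
    unfolding C_def
    by (subst block_operator_symmetric_iff)
      (simp_all add: zero weighted_reflection_adjoint_iff sharp_def del: comp_apply,
       simp_all add: weighted_reflection_adjoint_iff)
  have sq: "x * cnj x = complex_of_real ((cmod x)\<^sup>2)" for x
    by (simp flip: complex_norm_square)
  have "C \<circ> C = id \<longleftrightarrow> ?m1 \<and> ?m4 \<and> ?o" if ?s1 ?s4
  proof -
    have inv: "C \<circ> C = id \<longleftrightarrow>
      (AE z in circle_measure. \<psi>1 z * sharp \<psi>1 z + \<psi>2 z * cnj (\<psi>2 z) = 1) \<and>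
      (AE z in circle_measure. \<psi>1 z * sharp \<psi>2 z + \<psi>2 z * sharp \<psi>4 z = 0) \<and>
      (AE z in circle_measure. \<psi>2 (cnj z) * sharp \<psi>1 z + \<psi>4 z * cnj (\<psi>2 z) = 0) \<and>
      (AE z in circle_measure. \<psi>2 (cnj z) * sharp \<psi>2 z + \<psi>4 z * sharp \<psi>4 z = 1)"
      (is "_ \<longleftrightarrow> ?e1 \<and> ?e2 \<and> ?e3 \<and> ?e4")
      unfolding C_def by (subst block_weighted_reflection_involution_iff) (simp_all add: sharp_def)
    have s: "AE z in circle_measure. \<psi>1 (cnj z) = \<psi>1 z" "AE z in circle_measure. \<psi>4 (cnj z) = \<psi>4 z"
      using that by (simp_all add: sharp_def)
    have "?e1 \<and> ?e2 \<and> ?e3 \<and> ?e4 \<longleftrightarrow> ?m1 \<and> ?m4 \<and> ?o"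
    proof (intro iffI conjI; elim conjE)
      assume e: ?e1 ?e2 ?e3 ?e4
      have m1: "AE z in circle_measure. (cmod (\<psi>1 z))\<^sup>2 = 1 - (cmod (\<psi>2 z))\<^sup>2"
        using e(1) s(1)
      proof eventually_elim
        case (elim z)
        then have "complex_of_real ((cmod (\<psi>1 z))\<^sup>2 + (cmod (\<psi>2 z))\<^sup>2) = of_real 1"
          by (simp add: sharp_def sq)
        then show ?case by (simp only: of_real_eq_iff)
      qed
      \<comment> \<open>The lower row carries the reflected symbol of \<open>\<psi>2\<close>, so its equations are evaluated at
        \<open>cnj z\<close>.\<close>
      show m4: ?m4
        using AE_circle_cnj[OF e(4)] s(2)
      proof eventually_elim
        case (elim z)
        then have "complex_of_real ((cmod (\<psi>4 z))\<^sup>2 + (cmod (\<psi>2 z))\<^sup>2) = of_real 1"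
          by (simp add: sharp_def sq add.commute)
        then show ?case by (simp only: of_real_eq_iff)
      qed
      show ?m1 using m1 m4 by eventually_elim simp
      show ?o using AE_circle_cnj[OF e(3)] s
        by eventually_elim (simp add: sharp_def mult.commute)
    next
      assume m: ?m1 ?m4 and o: ?o
      show ?e1 using m s(1)
      proof eventually_elim
        case (elim z)
        then show ?case by (simp add: sharp_def sq flip: of_real_add)
      qed
      show ?e2 using AE_circle_cnj[OF o] 
      proof eventually_elim
        case (elim z)
        from arg_cong[OF this, of cnj] show ?case by (simp add: sharp_def mult.commute)
      qed
      show ?e3 using AE_circle_cnj[OF o] s
        by eventually_elim (simp add: sharp_def mult.commute)
      show ?e4 using AE_circle_cnj[OF m(2)] s(2)
      proof eventually_elim
        case (elim z)
        then show ?case by (simp add: sharp_def sq flip: of_real_add)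
      qed
    qed
    with inv show ?thesis by simp
  qed
  then show ?thesis
    using symmetric C by (simp only: conjugation_iff_symmetric) blast
qed

theorem theorem2p1:
  fixes C :: "L2_circle \<times> L2_circle \<Rightarrow> L2_circle \<times> L2_circle"
    and D1 D2 D4 :: "L2_circle \<Rightarrow> L2_circle"
  assumes "antilinear C"
    and "bounded_antilinear D1" and "bounded_antilinear D2" and "bounded_antilinear D4"
    and "C = block_operator D1 D2 (antilinear_adjoint D2) D4"
  shows "conjugation C \<and> bold_M_z \<circ> C = C \<circ> bold_M_z \<longleftrightarrow>
    (\<exists>\<psi>1\<in>Linfty. \<exists>\<psi>2\<in>Linfty. \<exists>\<psi>4\<in>Linfty.
       D1 = mult_op \<psi>1 \<circ> J_star \<and> D2 = mult_op \<psi>2 \<circ> J_star \<and> D4 = mult_op \<psi>4 \<circ> J_star \<and>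
       (AE z in circle_measure. sharp \<psi>1 z = cnj (\<psi>1 z)) \<and>
       (AE z in circle_measure. sharp \<psi>4 z = cnj (\<psi>4 z)) \<and>
       (AE z in circle_measure. (cmod (\<psi>1 z))\<^sup>2 = (cmod (\<psi>4 z))\<^sup>2) \<and>
       (AE z in circle_measure. (cmod (\<psi>4 z))\<^sup>2 = 1 - (cmod (\<psi>2 z))\<^sup>2) \<and>
       (AE z in circle_measure. sharp \<psi>1 z * \<psi>2 z + sharp \<psi>2 z * \<psi>4 z = 0))"
    (is "_ \<longleftrightarrow> ?symbols")
proof
  \<comment> \<open>To isolate single blocks, every entry must vanish at \<open>0\<close>. For the adjoint entry this comes
    from antilinearity of \<open>C\<close>, as the adjoint has no usable description at this point.\<close>
  have D_zero: "D1 0 = 0" "D2 0 = 0" "D4 0 = 0"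
    using assms(2-4) by (auto simp: bounded_antilinear_def antilinear_zero)
  have E_zero: "antilinear_adjoint D2 0 = 0"
    using antilinear_zero[OF assms(1)] assms(5) D_zero
    by (simp add: block_operator_def zero_prod_def)
  have M_zero: "M_z 0 = 0"
    using mult_op_add[OF id_in_Linfty, of 0 0] by simp
  assume conj_comm: "conjugation C \<and> bold_M_z \<circ> C = C \<circ> bold_M_z"
  have comm: "bold_M_z (C x) = C (bold_M_z x)" for x
    using conj_comm by (metis comp_apply)
  have M_z_comm: "D1 (M_z f) = M_z (D1 f)" "D2 (M_z f) = M_z (D2 f)" "D4 (M_z f) = M_z (D4 f)" for f
    using comm[of "(f, 0)"] comm[of "(0, f)"]
    by (simp_all add: assms(5) bold_M_z_def block_operator_def D_zero E_zero M_zero)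
  obtain \<psi>1 \<psi>2 \<psi>4 where \<psi>: "\<psi>1 \<in> Linfty" "\<psi>2 \<in> Linfty" "\<psi>4 \<in> Linfty"
    and D: "D1 = mult_op \<psi>1 \<circ> J_star" "D2 = mult_op \<psi>2 \<circ> J_star" "D4 = mult_op \<psi>4 \<circ> J_star"
    using shift_commuting_antilinear[OF assms(2)] shift_commuting_antilinear[OF assms(3)]
      shift_commuting_antilinear[OF assms(4)] M_z_comm by metis
  have "C = block_operator (mult_op \<psi>1 \<circ> J_star) (mult_op \<psi>2 \<circ> J_star)
      (mult_op (\<lambda>z. \<psi>2 (cnj z)) \<circ> J_star) (mult_op \<psi>4 \<circ> J_star)"
    using assms(5) by (simp only: D antilinear_adjoint_weighted_reflection[OF \<psi>(2)])
  from block_weighted_reflection_conjugation_iff[OF \<psi> assms(1) this] conj_comm \<psi> D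
  show ?symbols by blast
next
  assume ?symbols
  then obtain \<psi>1 \<psi>2 \<psi>4 where \<psi>: "\<psi>1 \<in> Linfty" "\<psi>2 \<in> Linfty" "\<psi>4 \<in> Linfty"
    and D: "D1 = mult_op \<psi>1 \<circ> J_star" "D2 = mult_op \<psi>2 \<circ> J_star" "D4 = mult_op \<psi>4 \<circ> J_star"
    and ae: "AE z in circle_measure. sharp \<psi>1 z = cnj (\<psi>1 z)"
       "AE z in circle_measure. sharp \<psi>4 z = cnj (\<psi>4 z)"
       "AE z in circle_measure. (cmod (\<psi>1 z))\<^sup>2 = (cmod (\<psi>4 z))\<^sup>2"
       "AE z in circle_measure. (cmod (\<psi>4 z))\<^sup>2 = 1 - (cmod (\<psi>2 z))\<^sup>2"
       "AE z in circle_measure. sharp \<psi>1 z * \<psi>2 z + sharp \<psi>2 z * \<psi>4 z = 0"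
    by blast
  have C: "C = block_operator (mult_op \<psi>1 \<circ> J_star) (mult_op \<psi>2 \<circ> J_star)
      (mult_op (\<lambda>z. \<psi>2 (cnj z)) \<circ> J_star) (mult_op \<psi>4 \<circ> J_star)"
    using assms(5) by (simp only: D antilinear_adjoint_weighted_reflection[OF \<psi>(2)])
  have "M_z (mult_op \<psi> (J_star x)) = mult_op \<psi> (J_star (M_z x))" if "\<psi> \<in> Linfty" for \<psi> x
    using that by (simp add: J_star_M_z mult_op_mult_op id_in_Linfty mult.commute)
  then have "bold_M_z \<circ> C = C \<circ> bold_M_z"
    by (auto simp: fun_eq_iff C bold_M_z_def block_operator_def mult_op_add id_in_Linfty
        \<psi> reflect_Linfty)
  with block_weighted_reflection_conjugation_iff[OF \<psi> assms(1) C] ae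
  show "conjugation C \<and> bold_M_z \<circ> C = C \<circ> bold_M_z" by blast
qed

end
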